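(* Let $K$ be a field, $S=K[t_1,\dots,t_s]$, and let $I\subset S$ be an unmixed graded ideal. Then $I\subsetneq(I:\mathfrak p)$ for $\mathfrak p\in\mathrm{Ass}(I)$, $$\mathrm v(I)=\min\{\alpha((I:\mathfrak p)/I) : \mathfrak p\in\mathrm{Ass}(I)\},$$ and $\alpha((I:\mathfrak p)/I)=\mathrm v_{\mathfrak p}(I)$ for $\mathfrak p\in\mathrm{Ass}(I)$.
   Context: $S=\bigoplus_{d\ge0}S_d$ has the standard grading; $K$ is arbitrary and $\mathfrak m=(t_1,\dots,t_s)$. $\mathrm{Ass}(I)$ denotes the set of associated primes of $S/I$, i.e. the prime ideals of the form $(I:f)$ with $f\in S$. An ideal is unmixed if all its associated primes have the same height. For a graded module $M\ne0$, $\alpha(M)=\min\{\deg(f) : f\in M,\ f\ne0\}$ (least degree of a nonzero homogeneous element); by convention $\alpha(0)=0$. The v-number of a graded ideal $I$ is $\mathrm v(I)=\min\{d\ge1 : \text{there exist } f\in S_d \text{ and } \mathfrak p\in\mathrm{Ass}(I)\text{ with }(I:f)=\mathfrak p\}$ if $I\subsetneq\mathfrak m$, and $\mathrm v(I)=0$ if $I=\mathfrak m$. For a graded ideal $I\subsetneq\mathfrak m$ and $\mathfrak p\in\mathrm{Ass}(I)$, the local v-number is $\mathrm v_{\mathfrak p}(I)=\min\{d\ge1 : \text{there exists } f\in S_d\text{ with }(I:f)=\mathfrak p\}$.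
   Formalization: The two v-number equalities are stated only when I is not a prime ideal different from 𝔪; for a graded prime I ≠ 𝔪 (e.g. I = 0) they fail, since α((I:I)/I) = 0 while v(I) = v_I(I) ≥ 1 as the definitions require d ≥ 1. *)

theory Defs
  imports
    "HOL-Library.Poly_Mapping"
    "HOL-Library.Extended_Nat"
    "HOL-Algebra.QuotRing"
    "HOL-Algebra.Algebraic_Closure_Type"
begin

text \<open>
  \<open>('n, 'k) mpoly\<close> is the polynomial ring \<open>K[t_1, ..., t_s]\<close>, where the finite index type \<open>'n\<close>
  has \<open>s\<close> elements: exponent vectors are maps \<open>'n \<Rightarrow>\<^sub>0 nat\<close> and a polynomial maps each exponent
  vector to its coefficient. Its ring structure is the convolution product of \<open>Poly_Mapping\<close>.
\<close>
type_synonym ('n, 'k) mpoly = "('n \<Rightarrow>\<^sub>0 nat) \<Rightarrow>\<^sub>0 'k"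

abbreviation S_ring :: "('n::finite, 'k::field) mpoly ring"
  where "S_ring \<equiv> ring_of_type_algebra"

definition var :: "'n::finite \<Rightarrow> ('n, 'k::field) mpoly"
  where "var i = Poly_Mapping.single (Poly_Mapping.single i 1) 1"

definition max_ideal :: "('n::finite, 'k::field) mpoly set"
  where "max_ideal = genideal S_ring (range var)"

definition mon_deg :: "('n::finite \<Rightarrow>\<^sub>0 nat) \<Rightarrow> nat"
  where "mon_deg m = (\<Sum>i\<in>UNIV. Poly_Mapping.lookup m i)"

text \<open>The component \<open>S_d\<close> of the standard grading; it contains \<open>0\<close> for every \<open>d\<close>.\<close>
definition hom_comp :: "nat \<Rightarrow> ('n::finite, 'k::field) mpoly set"
  where "hom_comp d = {f. \<forall>m\<in>Poly_Mapping.keys f. mon_deg m = d}"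

definition hom_part :: "nat \<Rightarrow> ('n::finite, 'k::field) mpoly \<Rightarrow> ('n, 'k) mpoly"
  where "hom_part d f = Poly_Mapping.mapp (\<lambda>m c. if mon_deg m = d then c else 0) f"

definition graded_ideal :: "('n::finite, 'k::field) mpoly set \<Rightarrow> bool"
  where "graded_ideal I \<longleftrightarrow> ideal I S_ring \<and> (\<forall>f\<in>I. \<forall>d. hom_part d f \<in> I)"

text \<open>The colon ideal \<open>(I : A)\<close>; the ideal \<open>(I : f)\<close> is \<open>colon I {f}\<close>.\<close>
definition colon :: "('n::finite, 'k::field) mpoly set \<Rightarrow> ('n, 'k) mpoly set \<Rightarrow> ('n, 'k) mpoly set"
  where "colon I A = {g. \<forall>f\<in>A. g * f \<in> I}"

definition Ass :: "('n::finite, 'k::field) mpoly set \<Rightarrow> ('n, 'k) mpoly set set"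
  where "Ass I = {p. primeideal p S_ring \<and> (\<exists>f. p = colon I {f})}"

definition height :: "('n::finite, 'k::field) mpoly set \<Rightarrow> enat"
  where "height p = Sup {enat n | n. \<exists>P. (\<forall>i\<le>n. primeideal (P i) S_ring) \<and>
           (\<forall>i<n. P i \<subset> P (Suc i)) \<and> P n = p}"

definition unmixed :: "('n::finite, 'k::field) mpoly set \<Rightarrow> bool"
  where "unmixed I \<longleftrightarrow> (\<forall>p\<in>Ass I. \<forall>q\<in>Ass I. height p = height q)"

text \<open>
  The least degree of a nonzero homogeneous element of a graded module, which is given by its zero
  element \<open>z\<close> and its family \<open>M\<close> of homogeneous components; the value is \<open>0\<close> for the zero module.
\<close>
definition alpha :: "'m \<Rightarrow> (nat \<Rightarrow> 'm set) \<Rightarrow> nat"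
  where "alpha z M = (if \<forall>d. M d \<subseteq> {z} then 0 else (LEAST d. \<exists>x\<in>M d. x \<noteq> z))"

text \<open>
  The degree \<open>d\<close> component of the graded module \<open>J / I\<close>, for graded ideals \<open>I \<subseteq> J\<close>: the cosets of
  the degree \<open>d\<close> elements of \<open>J\<close>. The zero element of \<open>J / I\<close> is the coset \<open>I\<close>.
\<close>
definition quot_comp ::
    "('n::finite, 'k::field) mpoly set \<Rightarrow> ('n, 'k) mpoly set \<Rightarrow> nat \<Rightarrow> ('n, 'k) mpoly set set"
  where "quot_comp J I d = {I +>\<^bsub>S_ring\<^esub> f | f. f \<in> J \<inter> hom_comp d}"

definition alpha_quot :: "('n::finite, 'k::field) mpoly set \<Rightarrow> ('n, 'k) mpoly set \<Rightarrow> nat"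
  where "alpha_quot J I = alpha I (quot_comp J I)"

text \<open>
  Degree \<open>0\<close> is excluded from the minimum. Since a nonzero constant \<open>f\<close> has \<open>(I : f) = I\<close>, this
  matters exactly when \<open>I\<close> is prime: for a graded prime ideal \<open>I\<close> different from \<open>(t_1, ..., t_s)\<close>
  the v-number is \<open>1\<close>, although \<open>\<alpha>((I : I) / I) = \<alpha>(S / I) = 0\<close>.
\<close>
definition v_number :: "('n::finite, 'k::field) mpoly set \<Rightarrow> nat"
  where "v_number I = (if I = max_ideal then 0
           else (LEAST d. d \<ge> 1 \<and> (\<exists>f\<in>hom_comp d. \<exists>p\<in>Ass I. colon I {f} = p)))"

text \<open>The case \<open>I = (t_1, ..., t_s)\<close> follows the convention for the v-number.\<close>
definition local_v_number :: "('n::finite, 'k::field) mpoly set \<Rightarrow> ('n, 'k) mpoly set \<Rightarrow> nat"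
  where "local_v_number p I = (if I = max_ideal then 0
           else (LEAST d. d \<ge> 1 \<and> (\<exists>f\<in>hom_comp d. colon I {f} = p)))"

end

theory Submission
  imports Defs
begin

text \<open>
  For \<open>p \<in> Ass I\<close> the point is that a homogeneous \<open>f\<close> satisfies \<open>(I : f) = p\<close> iff
  \<open>f \<in> (I : p)\<close> and \<open>f \<notin> I\<close>. If \<open>f \<in> (I : p) - I\<close>, then \<open>p \<subseteq> (I : f) \<subseteq> q\<close> for some
  \<open>q \<in> Ass I\<close>, because the ring is Noetherian; \<open>p\<close> and \<open>q\<close> have the same height, and this
  height is finite, so \<open>p = q\<close>. Homogeneous elements with \<open>(I : f) = p\<close> exist since \<open>I\<close> is graded,
  and their degree is positive unless \<open>I\<close> is prime.
\<close>

section \<open>Ideals of the polynomial ring\<close>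

text \<open>Heights are compared in \<open>enat\<close>, so equal heights exclude a strict inclusion
  of primes only once they are known to be finite; if both were infinite, nothing would follow. The
  bound on chains of primes comes from a count: elements picked between consecutive primes of a
  chain of length n are algebraically independent, so there are M^n distinct products with exponents
  below M, all independent over K, while they lie in a space whose dimension grows only like M^s.
  The prime q above (I : f) is a maximal colon ideal; the ascending chain condition behind it comes
  from Dickson's lemma and reduction of leading terms. \<open>Ass\<close> allows arbitrary f,
  whereas \<open>v_number\<close> and \<open>alpha_quot\<close> see only homogeneous elements. A
  homogeneous witness for each p is therefore what makes the minima on both sides range over
  nonempty sets.\<close>

lemma ideal_S_ring_iff:
  fixes I :: "('n::finite, 'k::field) mpoly set"
  shows "ideal I S_ring \<longleftrightarrow> 0 \<in> I \<and> (\<forall>a\<in>I. \<forall>b\<in>I. a + b \<in> I) \<and> (\<forall>a\<in>I. \<forall>x. x * a \<in> I)"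
    (is "_ \<longleftrightarrow> ?R")
proof
  assume I: "ideal I S_ring"
  interpret ideal I S_ring by fact
  show ?R
    using additive_subgroup.zero_closed[OF additive_subgroup_axioms]
      additive_subgroup.a_closed[OF additive_subgroup_axioms] I_l_closed
    by (simp add: ring_of_type_algebra_def)
next
  assume I: ?R
  interpret S: cring "S_ring :: ('n, 'k) mpoly ring"
    by (rule cring_from_type_algebra)
  have minus: "- a \<in> I" if "a \<in> I" for a
    using I that by (metis mult_minus1)
  have inv: "\<ominus>\<^bsub>S_ring\<^esub> a = - a" for a :: "('n, 'k) mpoly"
    by (rule S.minus_equality) (simp_all add: ring_of_type_algebra_def)
  show "ideal I S_ring"
  proof (rule idealI)
    show "subgroup I (add_monoid S_ring)"
    proof (rule S.add.subgroupI)
      show "I \<noteq> {}" using I by blast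
      show "\<ominus>\<^bsub>S_ring\<^esub> a \<in> I" if "a \<in> I" for a
        using minus that by (simp add: inv)
    qed (use I in \<open>auto simp: ring_of_type_algebra_def\<close>)
  qed (use I in \<open>auto simp: ring_of_type_algebra_def mult.commute S.ring_axioms[unfolded ring_of_type_algebra_def]\<close>)
qed

context
  fixes I :: "('n::finite, 'k::field) mpoly set"
  assumes I: "ideal I S_ring"
begin

lemma ideal_zero: "0 \<in> I"
  and ideal_add: "a \<in> I \<Longrightarrow> b \<in> I \<Longrightarrow> a + b \<in> I"
  and ideal_mult: "a \<in> I \<Longrightarrow> x * a \<in> I"
  using I by (auto simp: ideal_S_ring_iff)

lemma ideal_mult_right: "a \<in> I \<Longrightarrow> a * x \<in> I"
  using ideal_mult by (simp add: mult.commute)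

lemma ideal_uminus: "a \<in> I \<Longrightarrow> - a \<in> I"
  using ideal_mult[of a "-1"] by simp

lemma ideal_diff: "a \<in> I \<Longrightarrow> b \<in> I \<Longrightarrow> a - b \<in> I"
  using ideal_add[of a "- b"] ideal_uminus by simp

lemma ideal_sum: "(\<And>x. x \<in> A \<Longrightarrow> f x \<in> I) \<Longrightarrow> sum f A \<in> I"
  by (induction A rule: infinite_finite_induct) (auto simp: ideal_zero ideal_add)

lemma ideal_cancel: "a - b \<in> I \<Longrightarrow> a \<in> I \<longleftrightarrow> b \<in> I"
  using ideal_diff[of a "a - b"] ideal_add[of "a - b" b] by auto

lemma ideal_eq_UNIV: "1 \<in> I \<Longrightarrow> I = UNIV"
  using ideal_mult[of 1] by auto

lemma const_notin_ideal: "I \<noteq> UNIV \<Longrightarrow> Poly_Mapping.single 0 c \<in> I \<longleftrightarrow> c = 0"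
  using ideal_mult[of "Poly_Mapping.single 0 c" "Poly_Mapping.single 0 (1 / c)"] ideal_eq_UNIV
  by (cases "c = 0") (auto simp: mult_single ideal_zero)

lemma ideal_colon: "ideal (colon I A) S_ring"
  by (auto simp: ideal_S_ring_iff colon_def ideal_zero distrib_right mult.assoc
      intro: ideal_add ideal_mult)

lemma ideal_subset_colon: "I \<subseteq> colon I A"
  by (auto simp: colon_def ideal_mult_right)

lemma colon_cong: "a - b \<in> I \<Longrightarrow> colon I {a} = colon I {b}"
  using ideal_mult[of "a - b"] ideal_cancel
  by (auto simp: colon_def right_diff_distrib)

lemma colon_subset_colon_mult: "colon I {f} \<subseteq> colon I {a * f}"
proof
  fix x assume "x \<in> colon I {f}"
  then show "x \<in> colon I {a * f}"
    using ideal_mult[of "x * f" a] by (simp add: colon_def mult.left_commute)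
qed

text \<open>Primality cancels r: g * r * f lies in I iff g * r lies in p iff g does. So a witness of
  p may be multiplied by anything outside p, which supplies the competitors in the minimality
  argument for homogeneous witnesses.\<close>

lemma colon_prime_eq:
  assumes "colon I {f} = p" "primeideal p S_ring" "r \<notin> p"
  shows "colon I {r * f} = p"
proof -
  interpret p: primeideal p S_ring by fact
  have "g * r \<in> p \<longleftrightarrow> g \<in> p" for g
    using p.I_prime[of g r] p.I_r_closed[of g r] \<open>r \<notin> p\<close> by (auto simp: ring_of_type_algebra_def)
  then have "g * (r * f) \<in> I \<longleftrightarrow> g \<in> p" for g
    using assms(1) by (auto simp: colon_def mult.assoc[symmetric])
  then show ?thesis by (simp add: colon_def)
qed

lemma colon_coset_eq_iff: "I +>\<^bsub>S_ring\<^esub> f = I \<longleftrightarrow> f \<in> I"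
proof -
  have "I +>\<^bsub>S_ring\<^esub> f = (\<lambda>x. x + f) ` I"
    by (auto simp: a_r_coset_def' ring_of_type_algebra_def)
  moreover have "f \<in> I" if "(\<lambda>x. x + f) ` I = I"
    using ideal_zero that by (metis add_0 image_eqI)
  moreover have "(\<lambda>x. x + f) ` I = I" if "f \<in> I"
  proof
    show "(\<lambda>x. x + f) ` I \<subseteq> I" using that ideal_add by auto
    show "I \<subseteq> (\<lambda>x. x + f) ` I"
    proof
      fix y assume "y \<in> I"
      then show "y \<in> (\<lambda>x. x + f) ` I"
        using that ideal_diff[of y f] by (intro image_eqI[of _ _ "y - f"]) auto
    qed
  qed
  ultimately show ?thesis by blast
qed

end

lemma primeideal_S_ring_iff:
  fixes p :: "('n::finite, 'k::field) mpoly set"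
  shows "primeideal p S_ring \<longleftrightarrow> ideal p S_ring \<and> p \<noteq> UNIV \<and> (\<forall>a b. a * b \<in> p \<longrightarrow> a \<in> p \<or> b \<in> p)"
    (is "_ \<longleftrightarrow> ?R")
proof
  assume "primeideal p S_ring"
  then interpret primeideal p S_ring .
  show ?R
    using is_ideal I_notcarr I_prime by (auto simp: ring_of_type_algebra_def)
next
  assume ?R
  then show "primeideal p S_ring"
    by (intro primeidealI cring_from_type_algebra) (auto simp: ring_of_type_algebra_def)
qed

lemma primeideal_power_mult:
  fixes p :: "('n::finite, 'k::field) mpoly set"
  assumes "primeideal p S_ring" "x \<notin> p" "x ^ r * y \<in> p"
  shows "y \<in> p"
  using assms(3)
proof (induction r)
  case (Suc r)
  have "x * (x ^ r * y) \<in> p"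
    using Suc.prems by (simp add: mult.assoc)
  then have "x ^ r * y \<in> p"
    using assms(1,2) unfolding primeideal_S_ring_iff by blast
  then show ?case by (rule Suc.IH)
qed simp

section \<open>Finiteness of heights\<close>

text \<open>Downward induction on k. The least power of \<open>g k\<close> in the terms with nonzero
  coefficient can be cancelled, because \<open>P k\<close> is prime and misses \<open>g k\<close>.
  Modulo \<open>P (Suc k)\<close>, which contains \<open>g k\<close>, only the terms with that least
  exponent survive, and they form a relation among the remaining \<open>g i\<close>. At k = n a
  constant in a proper ideal is left. For k = 0 the result contains the algebraic independence of
  the \<open>g i\<close>.\<close>

lemma prime_chain_relation:
  fixes P :: "nat \<Rightarrow> ('n::finite, 'k::field) mpoly set"
  assumes prime: "\<And>i. i \<le> n \<Longrightarrow> primeideal (P i) S_ring"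
    and sub: "\<And>i. i < n \<Longrightarrow> P i \<subseteq> P (Suc i)"
    and g: "\<And>i. i < n \<Longrightarrow> g i \<in> P (Suc i) - P i"
    and "k \<le> n" "finite A"
    and "\<And>a b. a \<in> A \<Longrightarrow> b \<in> A \<Longrightarrow> \<forall>i\<in>{k..<n}. a i = b i \<Longrightarrow> a = b"
    and "(\<Sum>a\<in>A. Poly_Mapping.single 0 (c a) * (\<Prod>i=k..<n. g i ^ a i)) \<in> P k"
    and "a \<in> A"
  shows "c a = 0"
  using assms(4-)
proof (induction k arbitrary: A a rule: inc_induct)
  case base
  have "A = {a}"
    using base by auto
  then have "Poly_Mapping.single 0 (c a) \<in> P n"
    using base by simp
  then show ?case
    using prime[of n] const_notin_ideal[of "P n" "c a"] by (auto simp: primeideal_S_ring_iff)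
next
  case (step k)
  show ?case
  proof (rule ccontr)
    assume "c a \<noteq> 0"
    \<comment> \<open>Without the zero coefficients, the least exponent \<open>r\<close> is attained
      at a term \<open>b0\<close> with \<open>c b0\<close> nonzero, which the induction hypothesis
      then refutes.\<close>
    define B where "B = {b \<in> A. c b \<noteq> 0}"
    have B: "finite B" "B \<noteq> {}" "B \<subseteq> A"
      using step.prems \<open>c a \<noteq> 0\<close> by (auto simp: B_def)
    define r where "r = Min ((\<lambda>b. b k) ` B)"
    have r: "r \<le> b k" if "b \<in> B" for b
      using that B by (auto simp: r_def)
    have "r \<in> (\<lambda>b. b k) ` B"
      unfolding r_def using B by (intro Min_in) auto
    then obtain b0 where b0: "b0 \<in> B" "b0 k = r" by auto
    define t where "t b = Poly_Mapping.single 0 (c b) * (\<Prod>i=Suc k..<n. g i ^ b i)" for b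
    have ideal_k: "ideal (P (Suc k)) S_ring"
      using prime[of "Suc k"] step by (simp add: primeideal_S_ring_iff)
    have "(\<Sum>a\<in>A. Poly_Mapping.single 0 (c a) * (\<Prod>i=k..<n. g i ^ a i)) =
          (\<Sum>a\<in>B. Poly_Mapping.single 0 (c a) * (\<Prod>i=k..<n. g i ^ a i))"
      using step.prems B by (intro sum.mono_neutral_right) (auto simp: B_def)
    also have "\<dots> = (\<Sum>a\<in>B. g k ^ r * (g k ^ (a k - r) * t a))"
    proof (rule sum.cong[OF refl])
      fix b assume "b \<in> B"
      then have "g k ^ b k = g k ^ r * g k ^ (b k - r)"
        using r[of b] by (simp flip: power_add)
      then show "Poly_Mapping.single 0 (c b) * (\<Prod>i=k..<n. g i ^ b i) = g k ^ r * (g k ^ (b k - r) * t b)"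
        using step.hyps by (simp add: t_def prod.atLeast_Suc_lessThan mult_ac)
    qed
    finally have "g k ^ r * (\<Sum>a\<in>B. g k ^ (a k - r) * t a) \<in> P k"
      using step.prems by (simp add: sum_distrib_left)
    then have "(\<Sum>a\<in>B. g k ^ (a k - r) * t a) \<in> P k"
    proof (rule primeideal_power_mult[rotated -1])
      show "primeideal (P k) S_ring" "g k \<notin> P k"
        using prime[of k] g[of k] step.hyps by auto
    qed
    then have "(\<Sum>a\<in>B. g k ^ (a k - r) * t a) \<in> P (Suc k)"
      using sub[of k] step.hyps by auto
    moreover have "(\<Sum>a\<in>B. g k ^ (a k - r) * t a) =
        (\<Sum>a\<in>{b\<in>B. b k = r}. t a) + (\<Sum>a\<in>{b\<in>B. b k \<noteq> r}. g k ^ (a k - r) * t a)"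
    proof -
      have "(\<Sum>a\<in>B. g k ^ (a k - r) * t a) =
        (\<Sum>a\<in>{b\<in>B. b k = r}. g k ^ (a k - r) * t a) + (\<Sum>a\<in>{b\<in>B. b k \<noteq> r}. g k ^ (a k - r) * t a)"
        using B by (subst sum.union_disjoint[symmetric]) (auto intro: sum.cong)
      then show ?thesis by simp
    qed
    moreover have "(\<Sum>a\<in>{b\<in>B. b k \<noteq> r}. g k ^ (a k - r) * t a) \<in> P (Suc k)"
    proof (rule ideal_sum[OF ideal_k])
      fix b assume "b \<in> {b\<in>B. b k \<noteq> r}"
      then have "b k - r \<noteq> 0" using r[of b] by auto
      then obtain e where "b k - r = Suc e" by (cases "b k - r") auto
      then show "g k ^ (b k - r) * t b \<in> P (Suc k)"
        using g[of k] step.hyps by (auto intro!: ideal_mult_right[OF ideal_k])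
    qed
    ultimately have "(\<Sum>a\<in>{b\<in>B. b k = r}. t a) \<in> P (Suc k)"
      using ideal_cancel[OF ideal_k, of "\<Sum>a\<in>B. g k ^ (a k - r) * t a" "\<Sum>a\<in>{b\<in>B. b k = r}. t a"]
      by (simp only: add_diff_cancel_left')
    have "c b0 = 0"
    proof (rule step.IH[of "{b\<in>B. b k = r}"])
      show "finite {b\<in>B. b k = r}" "b0 \<in> {b\<in>B. b k = r}"
        using B b0 by auto
      show "(\<Sum>a\<in>{b\<in>B. b k = r}. Poly_Mapping.single 0 (c a) * (\<Prod>i=Suc k..<n. g i ^ a i)) \<in> P (Suc k)"
        using \<open>(\<Sum>a\<in>{b\<in>B. b k = r}. t a) \<in> P (Suc k)\<close> by (simp only: t_def)
      fix x y assume xy: "x \<in> {b\<in>B. b k = r}" "y \<in> {b\<in>B. b k = r}" "\<forall>i\<in>{Suc k..<n}. x i = y i"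
      have "x i = y i" if "i \<in> {k..<n}" for i
        using xy that by (cases "i = k") auto
      then show "x = y"
        using xy B by (intro step.prems(2)) auto
    qed
    then show False using b0 by (simp add: B_def)
  qed
qed

text \<open>Each exponent is bounded separately, not the total degree: the admissible monomials then
  form a box with (D + 1)^s elements, which is easy to count.\<close>

definition degree_bounded :: "nat \<Rightarrow> ('n::finite, 'k::field) mpoly set"
  where "degree_bounded D = {f. \<forall>m\<in>Poly_Mapping.keys f. \<forall>i. Poly_Mapping.lookup m i \<le> D}"

lemma degree_bounded_exists: "\<exists>D. f \<in> degree_bounded D"
proof -
  have "finite (\<Union>m\<in>Poly_Mapping.keys f. Poly_Mapping.lookup m ` UNIV)" by simp
  then show ?thesis
    unfolding degree_bounded_def finite_nat_set_iff_bounded_le by auto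
qed

lemma degree_bounded_mono: "D \<le> D' \<Longrightarrow> f \<in> degree_bounded D \<Longrightarrow> f \<in> degree_bounded D'"
  unfolding degree_bounded_def by (auto intro: order_trans)

lemma degree_bounded_mult:
  assumes "f \<in> degree_bounded D" "g \<in> degree_bounded E"
  shows "f * g \<in> degree_bounded (D + E)"
  using assms keys_mult[of f g] unfolding degree_bounded_def
  by (fastforce simp: lookup_add intro: add_mono)

lemma degree_bounded_one: "1 \<in> degree_bounded D"
  by (simp add: degree_bounded_def)

lemma degree_bounded_power: "f \<in> degree_bounded D \<Longrightarrow> f ^ k \<in> degree_bounded (k * D)"
  by (induction k) (auto simp: degree_bounded_one intro: degree_bounded_mult)

lemma degree_bounded_prod:
  "(\<And>i. i \<in> A \<Longrightarrow> f i \<in> degree_bounded D) \<Longrightarrow> prod f A \<in> degree_bounded (card A * D)"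
  by (induction A rule: infinite_finite_induct) (auto simp: degree_bounded_one intro: degree_bounded_mult)

lemma mpoly_sum_monomials:
  "f = (\<Sum>m\<in>Poly_Mapping.keys f. Poly_Mapping.single m (Poly_Mapping.lookup f m))"
proof (rule poly_mapping_eqI)
  fix k
  show "Poly_Mapping.lookup f k =
    Poly_Mapping.lookup (\<Sum>m\<in>Poly_Mapping.keys f. Poly_Mapping.single m (Poly_Mapping.lookup f m)) k"
    by (simp add: lookup_sum lookup_single when_def in_keys_iff sum.delta)
qed

text \<open>The \<open>g i\<close> below are algebraically independent, so the number of their monomials with
  exponents less than \<open>M\<close> is at most the number of monomials of the corresponding degree in the
  \<open>t_j\<close>.\<close>

lemma prime_chain_bounded:
  fixes P :: "nat \<Rightarrow> ('n::finite, 'k::field) mpoly set"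
  assumes prime: "\<And>i. i \<le> n \<Longrightarrow> primeideal (P i) S_ring"
    and sub: "\<And>i. i < n \<Longrightarrow> P i \<subset> P (Suc i)"
  shows "n \<le> card (UNIV :: 'n set)"
proof (rule ccontr)
  define s where "s = card (UNIV :: 'n set)"
  assume "\<not> n \<le> card (UNIV :: 'n set)"
  then have n: "Suc s \<le> n" by (simp add: s_def)
  have "\<forall>i. \<exists>g. i < n \<longrightarrow> g \<in> P (Suc i) - P i"
    using sub by blast
  then obtain g where g: "\<And>i. i < n \<Longrightarrow> g i \<in> P (Suc i) - P i" by metis
  have "\<exists>D. \<forall>i. g i \<in> degree_bounded (D i)"
    using degree_bounded_exists by (intro choice) blast
  then obtain D where D: "\<And>i. g i \<in> degree_bounded (D i)" by blast
  define E where "E = (\<Sum>i<n. D i)"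
  have E: "g i \<in> degree_bounded E" if "i < n" for i
  proof (rule degree_bounded_mono[OF _ D])
    show "D i \<le> E"
      unfolding E_def using that by (intro member_le_sum) simp_all
  qed
  \<comment> \<open>The M^n products \<open>F a\<close> will lie in the span of at most M^s * (n * E
    + 1)^s monomials. For n > s this forces M to be at most (n * E + 1)^s, so \<open>M\<close> is
    taken one larger.\<close>
  define M where "M = Suc ((n * E + 1) ^ s)"
  define A where "A = PiE {..<n} (\<lambda>_. {..<M})"
  define F where "F a = (\<Prod>i=0..<n. g i ^ a i)" for a :: "nat \<Rightarrow> nat"
  have finA: "finite A" and cardA: "card A = M ^ n"
    by (auto simp: A_def card_PiE finite_PiE)
  have ext: "a = b" if "a \<in> A" "b \<in> A" "\<forall>i\<in>{0..<n}. a i = b i" for a b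
    using that unfolding A_def by (intro PiE_ext) auto
  have rel: "c a = 0" if "Y \<subseteq> A" "(\<Sum>a\<in>Y. Poly_Mapping.single 0 (c a) * F a) = 0" "a \<in> Y" for c Y a
  proof (rule prime_chain_relation[where P = P and n = n and k = 0 and g = g and A = Y and c = c])
    show "(\<Sum>a\<in>Y. Poly_Mapping.single 0 (c a) * (\<Prod>i=0..<n. g i ^ a i)) \<in> P 0"
      using that(2) prime[of 0] by (simp add: F_def primeideal_S_ring_iff ideal_zero)
    show "finite Y" using that(1) finA finite_subset by blast
    show "a = b" if "a \<in> Y" "b \<in> Y" "\<forall>i\<in>{0..<n}. a i = b i" for a b
      using ext that \<open>Y \<subseteq> A\<close> by blast
  qed (use prime sub g that in auto)
  \<comment> \<open>Independence of the image of \<open>A\<close> under \<open>F\<close> does not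
    determine its size. A coincidence F a = F b is itself a nontrivial relation, with coefficients 1
    and -1.\<close>
  have inj: "inj_on F A"
  proof (rule inj_onI, rule ccontr)
    fix a b assume ab: "a \<in> A" "b \<in> A" "F a = F b" "a \<noteq> b"
    define c :: "(nat \<Rightarrow> nat) \<Rightarrow> 'k" where "c x = (if x = a then 1 else - 1)" for x
    have "c a = 0"
    proof (rule rel[of "{a, b}" c])
      show "(\<Sum>x\<in>{a, b}. Poly_Mapping.single 0 (c x) * F x) = 0"
        using ab by (simp add: c_def single_uminus)
    qed (use ab in auto)
    then show False by (simp add: c_def)
  qed
  \<comment> \<open>Each of the \<open>n\<close> factors \<open>g i ^ a i\<close> has exponents at
    most M * E, whence the side of the box.\<close>
  define T where "T = (\<lambda>m. Poly_Mapping.single m (1::'k)) ` {m :: 'n \<Rightarrow>\<^sub>0 nat. \<forall>i. Poly_Mapping.lookup m i \<le> n * M * E}"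
  \<comment> \<open>K acts through multiplication by constant polynomials, so that the comparison of
    independent and spanning sets from linear algebra applies.\<close>
  interpret V: vector_space "\<lambda>(c::'k) (f::('n,'k) mpoly). Poly_Mapping.single 0 c * f"
    by unfold_locales (auto simp: algebra_simps single_add mult_single mult.assoc[symmetric])
  have lookup_inj: "inj_on Poly_Mapping.lookup Y" for Y :: "('n \<Rightarrow>\<^sub>0 nat) set"
    by (auto intro: inj_onI poly_mapping_eqI)
  have sub_PiE: "Poly_Mapping.lookup ` {m :: 'n \<Rightarrow>\<^sub>0 nat. \<forall>i. Poly_Mapping.lookup m i \<le> n * M * E}
      \<subseteq> PiE UNIV (\<lambda>_. {..n * M * E})" by auto
  have fin_box: "finite {m :: 'n \<Rightarrow>\<^sub>0 nat. \<forall>i. Poly_Mapping.lookup m i \<le> n * M * E}"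
    by (rule inj_on_finite[OF lookup_inj sub_PiE]) (simp add: finite_PiE)
  then have finT: "finite T" by (simp add: T_def)
  have "card T \<le> card {m :: 'n \<Rightarrow>\<^sub>0 nat. \<forall>i. Poly_Mapping.lookup m i \<le> n * M * E}"
    unfolding T_def by (rule card_image_le[OF fin_box])
  also have "\<dots> \<le> card (PiE (UNIV :: 'n set) (\<lambda>_. {..n * M * E}))"
    by (rule card_inj_on_le[OF lookup_inj sub_PiE]) (simp add: finite_PiE)
  also have "\<dots> = (n * M * E + 1) ^ s"
    by (simp add: card_PiE s_def)
  also have "\<dots> \<le> (M * (n * E + 1)) ^ s"
    by (intro power_mono) (simp_all add: M_def algebra_simps)
  finally have cardT: "card T \<le> M ^ s * (n * E + 1) ^ s"
    by (simp only: power_mult_distrib)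
  have span: "F ` A \<subseteq> V.span T"
  proof safe
    fix a assume a: "a \<in> A"
    have "F a \<in> degree_bounded (card {0..<n} * (M * E))"
      unfolding F_def
    proof (rule degree_bounded_prod)
      fix i assume i: "i \<in> {0..<n}"
      then have "a i \<in> {..<M}" using a by (auto simp: A_def)
      then have "a i * E \<le> M * E" by (intro mult_right_mono) auto
      moreover have "g i ^ a i \<in> degree_bounded (a i * E)"
        using i by (intro degree_bounded_power E) simp
      ultimately show "g i ^ a i \<in> degree_bounded (M * E)"
        by (rule degree_bounded_mono)
    qed
    then have "Poly_Mapping.lookup m i \<le> n * M * E" if "m \<in> Poly_Mapping.keys (F a)" for m i
      using that by (simp add: degree_bounded_def mult.assoc)
    then have "Poly_Mapping.single m 1 \<in> T" if "m \<in> Poly_Mapping.keys (F a)" for m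
      using that unfolding T_def by blast
    then have "(\<Sum>m\<in>Poly_Mapping.keys (F a). Poly_Mapping.single 0 (Poly_Mapping.lookup (F a) m) *
        Poly_Mapping.single m 1) \<in> V.span T"
      by (intro V.span_sum V.span_scale V.span_base)
    then show "F a \<in> V.span T"
      by (subst mpoly_sum_monomials) (simp add: mult_single)
  qed
  have "V.independent (F ` A)"
  proof (rule V.independent_if_scalars_zero)
    fix c x assume c: "(\<Sum>x\<in>F ` A. Poly_Mapping.single 0 (c x) * x) = 0" and "x \<in> F ` A"
    then obtain a where a: "a \<in> A" "x = F a" by blast
    have "c (F a) = 0"
      using c a inj by (intro rel[of A "\<lambda>a. c (F a)"]) (auto simp: sum.reindex)
    then show "c x = 0" using a by simp
  qed (simp add: finA)
  then have "card (F ` A) \<le> card T"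
    using V.independent_span_bound[OF finT _ span] by simp
  then have "M ^ n \<le> M ^ s * (n * E + 1) ^ s"
    using cardT inj by (simp add: card_image cardA)
  moreover have "M ^ Suc s \<le> M ^ n"
    using n by (intro power_increasing) (auto simp: M_def)
  ultimately have "M ^ s * M \<le> M ^ s * (n * E + 1) ^ s"
    by (simp only: power_Suc2)
  moreover have "M ^ s > 0" by (simp add: M_def)
  ultimately show False
    by (simp add: M_def)
qed

text \<open>Chains ending in p have bounded length, so there is a longest one, and appending q gives
  a longer chain ending in q. The bound is essential: it makes the height of p finite, hence the
  inequality strict.\<close>

lemma height_strict_mono:
  fixes p q :: "('n::finite, 'k::field) mpoly set"
  assumes p: "primeideal p S_ring" and q: "primeideal q S_ring" and "p \<subset> q"
  shows "height p < height q"
proof -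
  define C where "C p n \<longleftrightarrow> (\<exists>P. (\<forall>i\<le>n. primeideal (P i) S_ring) \<and>
      (\<forall>i<n. P i \<subset> P (Suc i)) \<and> P n = p)" for p :: "('n, 'k) mpoly set" and n
  have height: "height p = Sup {enat n | n. C p n}" for p :: "('n, 'k) mpoly set"
    by (simp add: height_def C_def)
  have "C p 0"
    using p by (auto simp: C_def intro: exI[of _ "\<lambda>_. p"])
  moreover have bound: "n \<le> card (UNIV :: 'n set)" if "C p n" for n
    using that prime_chain_bounded[of n] unfolding C_def by blast
  ultimately obtain n where n: "C p n" "\<And>k. C p k \<Longrightarrow> k \<le> n"
    using Nat.ex_has_greatest_nat[of "C p" 0 "card (UNIV :: 'n set)"] by blast
  have "height p \<le> enat n"
    unfolding height by (rule Sup_least) (use n in auto)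
  also have "enat n < enat (Suc n)" by simp
  also have "\<dots> \<le> height q"
    unfolding height
  proof (rule Sup_upper)
    obtain P where P: "\<And>i. i \<le> n \<Longrightarrow> primeideal (P i) S_ring" "\<And>i. i < n \<Longrightarrow> P i \<subset> P (Suc i)" "P n = p"
      using n(1) unfolding C_def by blast
    have "C q (Suc n)"
      unfolding C_def
      by (rule exI[of _ "P(Suc n := q)"]) (use P q \<open>p \<subset> q\<close> in \<open>auto simp: le_Suc_eq less_Suc_eq\<close>)
    then show "enat (Suc n) \<in> {enat n | n. C q n}" by blast
  qed
  finally show ?thesis .
qed

section \<open>Noetherianity\<close>

lemma nat_seq_mono_subseq:
  fixes s :: "nat \<Rightarrow> nat"
  shows "\<exists>r::nat \<Rightarrow> nat. strict_mono r \<and> mono (\<lambda>n. s (r n))"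
proof -
  obtain f :: "nat \<Rightarrow> nat" where f: "strict_mono f" "monoseq (\<lambda>n. s (f n))"
    using seq_monosub[of s] by blast
  show ?thesis
  proof (cases "incseq (\<lambda>n. s (f n))")
    case True
    then show ?thesis using f(1) by (intro exI[of _ f]) (auto simp: mono_def incseq_def)
  next
    case False
    then have dec: "decseq (\<lambda>n. s (f n))"
      using f(2) by (simp add: monoseq_iff)
    \<comment> \<open>A decreasing sequence of naturals is constant from the index of its minimum
      on, so shifting by \<open>N\<close> gives a nondecreasing one.\<close>
    obtain N where N: "\<And>n. s (f N) \<le> s (f n)"
      using ex_has_least_nat[of "\<lambda>_. True" 0 "\<lambda>n. s (f n)"] by blast
    have "s (f (n + N)) = s (f N)" for n
      using N[of "n + N"] decseqD[OF dec, of N "n + N"] by simp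
    then show ?thesis
      using f(1) by (intro exI[of _ "\<lambda>n. f (n + N)"]) (auto simp: strict_mono_def mono_def)
  qed
qed

text \<open>Passing to a subsequence once per variable makes all exponents nondecreasing, and then
  the first two terms are comparable. Divisibility is stated with its cofactor \<open>d\<close>,
  which the reduction step multiplies by.\<close>

lemma dickson:
  fixes s :: "nat \<Rightarrow> ('n::finite \<Rightarrow>\<^sub>0 nat)"
  obtains i j d where "i < j" "s j = s i + d"
proof -
  have "\<exists>r::nat \<Rightarrow> nat. strict_mono r \<and> (\<forall>x\<in>Y. mono (\<lambda>n. Poly_Mapping.lookup (s (r n)) x))" if "finite Y" for Y
    using that
  proof (induction Y)
    case empty
    then show ?case by (auto intro: exI[of _ id] strict_mono_id)
  next
    case (insert x Y)
    then obtain r :: "nat \<Rightarrow> nat" where r: "strict_mono r" "\<And>y. y \<in> Y \<Longrightarrow> mono (\<lambda>n. Poly_Mapping.lookup (s (r n)) y)"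
      by blast
    obtain q :: "nat \<Rightarrow> nat"
      where q: "strict_mono q" "mono (\<lambda>n. Poly_Mapping.lookup (s (r (q n))) x)"
      using nat_seq_mono_subseq[of "\<lambda>n. Poly_Mapping.lookup (s (r n)) x"] by blast
    have "mono (\<lambda>n. Poly_Mapping.lookup (s (r (q n))) y)" if "y \<in> Y" for y
      using r(2)[OF that] strict_mono_mono[OF q(1)] by (simp add: mono_def)
    then show ?case
      using r(1) q by (intro exI[of _ "\<lambda>n. r (q n)"]) (auto simp: strict_mono_def)
  qed
  from this[of UNIV] obtain r :: "nat \<Rightarrow> nat" where r: "strict_mono r" "\<And>x. mono (\<lambda>n. Poly_Mapping.lookup (s (r n)) x)"
    by auto
  have "s (r 1) = s (r 0) + (s (r 1) - s (r 0))"
    using monoD[OF r(2), of 0 1] by (intro poly_mapping_eqI) (simp add: lookup_add lookup_minus)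
  moreover have "r 0 < r 1" using r(1) by (simp add: strict_mono_def)
  ultimately show ?thesis using that by blast
qed

text \<open>Numbering the variables makes the lexicographic order on \<open>nat \<Rightarrow>\<^sub>0 nat\<close> available as a
  monomial order.\<close>

definition mono_rank :: "('n::finite \<Rightarrow>\<^sub>0 nat) \<Rightarrow> (nat \<Rightarrow>\<^sub>0 nat)"
  where "mono_rank m = (\<Sum>i\<in>UNIV. Poly_Mapping.single ((SOME e. inj e) i) (Poly_Mapping.lookup m i))"

lemma mono_rank_add: "mono_rank (a + b) = mono_rank a + mono_rank b"
  by (simp add: mono_rank_def lookup_add single_add sum.distrib)

lemma inj_mono_rank: "inj (mono_rank :: ('n::finite \<Rightarrow>\<^sub>0 nat) \<Rightarrow> _)"
proof (rule injI, rule poly_mapping_eqI)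
  fix a b :: "'n \<Rightarrow>\<^sub>0 nat" and i
  assume eq: "mono_rank a = mono_rank b"
  define e :: "'n \<Rightarrow> nat" where "e = (SOME e. inj e)"
  have "\<exists>e :: 'n \<Rightarrow> nat. inj e"
    using finite_imp_inj_to_nat_seg[OF finite_UNIV] by metis
  then have e: "inj e" unfolding e_def by (rule someI_ex)
  have "Poly_Mapping.lookup (mono_rank m) (e i) = Poly_Mapping.lookup m i" for m :: "'n \<Rightarrow>\<^sub>0 nat"
    using e by (simp add: mono_rank_def e_def[symmetric] lookup_sum lookup_single when_def inj_eq)
  then show "Poly_Mapping.lookup a i = Poly_Mapping.lookup b i"
    using eq by metis
qed

lemma lex_nonneg: "0 \<le> (m :: nat \<Rightarrow>\<^sub>0 nat)"
proof (cases "m = 0")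
  case False
  then have "\<exists>k. Poly_Mapping.lookup m k \<noteq> 0"
    by (metis lookup_zero poly_mapping_eqI)
  then have "\<exists>k. Poly_Mapping.lookup m k \<noteq> 0 \<and> (\<forall>k'<k. Poly_Mapping.lookup m k' = 0)"
    using exists_least_iff[of "\<lambda>k. Poly_Mapping.lookup m k \<noteq> 0"] by auto
  then have "0 < m"
    by (auto simp: less_poly_mapping.rep_eq less_fun_def)
  then show ?thesis by simp
qed simp

text \<open>The lexicographic order on \<open>nat \<Rightarrow>\<^sub>0 nat\<close> has infinite
  descents, since it admits infinitely many variables. With finitely many, Dickson's lemma finds in
  any descent an earlier monomial dividing a later one, and a multiple never ranks below its
  divisor.\<close>

lemma wf_mono_rank: "wf {(a, b :: 'n::finite \<Rightarrow>\<^sub>0 nat). mono_rank a < mono_rank b}"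
  unfolding wf_iff_no_infinite_down_chain
proof
  assume "\<exists>s. \<forall>i. (s (Suc i), s i) \<in> {(a, b :: 'n \<Rightarrow>\<^sub>0 nat). mono_rank a < mono_rank b}"
  then obtain s :: "nat \<Rightarrow> 'n \<Rightarrow>\<^sub>0 nat" where s: "\<And>i. mono_rank (s (Suc i)) < mono_rank (s i)" by blast
  obtain i j d where ij: "i < j" "s j = s i + d" by (rule dickson)
  have "mono_rank (s j) < mono_rank (s i)"
    using lift_Suc_antimono_le[of "\<lambda>i. mono_rank (s i)" "Suc i" j] s ij(1)
    by (meson Suc_leI le_less_trans less_imp_le)
  moreover have "mono_rank (s i) \<le> mono_rank (s j)"
    using add_left_mono[OF lex_nonneg, of "mono_rank (s i)" "mono_rank d"] by (simp add: ij mono_rank_add)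
  ultimately show False by simp
qed

section \<open>Leading monomials and the ascending chain condition\<close>

definition lead_monomial :: "('n::finite, 'k::field) mpoly \<Rightarrow> ('n \<Rightarrow>\<^sub>0 nat)"
  where "lead_monomial f = (ARG_MAX mono_rank m. m \<in> Poly_Mapping.keys f)"

lemma lead_monomial:
  assumes "f \<noteq> 0"
  shows "lead_monomial f \<in> Poly_Mapping.keys f"
    and "m \<in> Poly_Mapping.keys f \<Longrightarrow> mono_rank m \<le> mono_rank (lead_monomial f)"
proof -
  have "Max (mono_rank ` Poly_Mapping.keys f) \<in> mono_rank ` Poly_Mapping.keys f"
    using assms by (intro Max_in) (auto simp: poly_mapping_eq_iff fun_eq_iff in_keys_iff)
  then obtain l where l: "l \<in> Poly_Mapping.keys f" "mono_rank l = Max (mono_rank ` Poly_Mapping.keys f)"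
    by auto
  then have "is_arg_max mono_rank (\<lambda>m. m \<in> Poly_Mapping.keys f) l"
    by (auto simp: is_arg_max_linorder)
  then have "is_arg_max mono_rank (\<lambda>m. m \<in> Poly_Mapping.keys f) (lead_monomial f)"
    unfolding lead_monomial_def arg_max_def by (rule someI)
  then show "lead_monomial f \<in> Poly_Mapping.keys f"
    and "m \<in> Poly_Mapping.keys f \<Longrightarrow> mono_rank m \<le> mono_rank (lead_monomial f)"
    by (auto simp: is_arg_max_linorder)
qed

lemma lookup_single_mult:
  fixes f :: "('n::finite, 'k::field) mpoly"
  shows "Poly_Mapping.lookup (Poly_Mapping.single d c * f) (m + d) = c * Poly_Mapping.lookup f m"
proof -
  have "m + d = d + q \<longleftrightarrow> m = q" for q by (auto simp: add.commute)
  then show ?thesis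
    by (simp add: lookup_mult lookup_single when_mult)
qed

lemma keys_single_mult:
  fixes f :: "('n::finite, 'k::field) mpoly"
  shows "Poly_Mapping.keys (Poly_Mapping.single d c * f) \<subseteq> (\<lambda>m. m + d) ` Poly_Mapping.keys f"
  using keys_mult[of "Poly_Mapping.single d c" f] by (auto simp: add.commute split: if_splits)

text \<open>In a strictly increasing chain pick \<open>f i \<in> J (i + 1) - J i\<close> with minimal leading monomial;
  when the leading monomial of \<open>f i\<close> divides that of \<open>f j\<close>, a reduction step contradicts the choice
  of \<open>f j\<close>.\<close>

lemma wf_ideals: "wf {(J', J :: ('n::finite, 'k::field) mpoly set).
    ideal J S_ring \<and> ideal J' S_ring \<and> J \<subset> J'}"
  unfolding wf_iff_no_infinite_down_chain
proof
  assume "\<exists>J. \<forall>i. (J (Suc i), J i) \<in> {(J', J :: ('n, 'k) mpoly set).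
    ideal J S_ring \<and> ideal J' S_ring \<and> J \<subset> J'}"
  then obtain J :: "nat \<Rightarrow> ('n, 'k) mpoly set"
    where J: "\<And>i. ideal (J i) S_ring" "\<And>i. J i \<subset> J (Suc i)" by blast
  have "\<exists>f\<in>J (Suc i) - J i. \<forall>g\<in>J (Suc i) - J i. \<not> mono_rank (lead_monomial g) < mono_rank (lead_monomial f)" for i
  proof -
    have "lead_monomial ` (J (Suc i) - J i) \<noteq> {}" using J(2)[of i] by auto
    from wfE_min'[OF wf_mono_rank this] obtain l
      where "l \<in> lead_monomial ` (J (Suc i) - J i)"
        and l: "\<And>l'. mono_rank l' < mono_rank l \<Longrightarrow> l' \<notin> lead_monomial ` (J (Suc i) - J i)"
      by (metis case_prodI mem_Collect_eq)
    then obtain f where "f \<in> J (Suc i) - J i" "l = lead_monomial f" by (elim imageE)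
    then show ?thesis using l by blast
  qed
  then obtain f where f: "\<And>i. f i \<in> J (Suc i) - J i"
    and min: "\<And>i g. g \<in> J (Suc i) - J i \<Longrightarrow> \<not> mono_rank (lead_monomial g) < mono_rank (lead_monomial (f i))"
    by metis
  obtain i j d where ij: "i < j" "lead_monomial (f j) = lead_monomial (f i) + d"
    by (rule dickson[of "\<lambda>i. lead_monomial (f i)"])
  have nz: "f k \<noteq> 0" for k
    using f[of k] ideal_zero[OF J(1)] by auto
  define ci cj where "ci = Poly_Mapping.lookup (f i) (lead_monomial (f i))"
    and "cj = Poly_Mapping.lookup (f j) (lead_monomial (f j))"
  have ci: "ci \<noteq> 0" using lead_monomial(1)[OF nz, of i] by (simp add: ci_def in_keys_iff)
  \<comment> \<open>The multiple of \<open>f i\<close> with the same leading term as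
    \<open>f j\<close>. Since i < j it lies in \<open>J j\<close>, so subtracting it lowers the
    leading monomial without moving \<open>f j\<close> into \<open>J j\<close>.\<close>
  define u where "u = Poly_Mapping.single d (cj / ci) * f i"
  define h where "h = f j - u"
  have "J (Suc i) \<subseteq> J j"
    using lift_Suc_mono_le[of J "Suc i" j] J(2) ij(1) by (simp add: less_imp_le)
  then have "u \<in> J j"
    unfolding u_def using f[of i] by (intro ideal_mult[OF J(1)]) auto
  then have "u \<in> J (Suc j)" using J(2)[of j] by auto
  then have h: "h \<in> J (Suc j) - J j"
    using f[of j] \<open>u \<in> J j\<close> ideal_add[OF J(1), of "f j - u" j u] ideal_diff[OF J(1)]
    by (auto simp: h_def)
  then have "h \<noteq> 0" using ideal_zero[OF J(1)] by auto
  have "Poly_Mapping.lookup h (lead_monomial (f j)) = 0"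
    using ci lookup_single_mult[of d "cj / ci" "f i" "lead_monomial (f i)"]
    by (simp add: h_def u_def lookup_minus ij(2)) (simp add: ci_def cj_def ij(2))
  then have "lead_monomial h \<noteq> lead_monomial (f j)"
    using lead_monomial(1)[OF \<open>h \<noteq> 0\<close>] by (auto simp: in_keys_iff)
  moreover have "mono_rank m \<le> mono_rank (lead_monomial (f j))" if "m \<in> Poly_Mapping.keys h" for m
  proof -
    have "m \<in> Poly_Mapping.keys (f j) \<or> m \<in> Poly_Mapping.keys u"
      using that by (auto simp: h_def in_keys_iff lookup_minus)
    then show ?thesis
    proof
      assume "m \<in> Poly_Mapping.keys u"
      then obtain m' where "m' \<in> Poly_Mapping.keys (f i)" "m = m' + d"
        using keys_single_mult[of d "cj / ci" "f i"] by (auto simp: u_def)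
      then show ?thesis
        using lead_monomial(2)[OF nz, of m' i] by (simp add: ij(2) mono_rank_add add_right_mono)
    qed (use lead_monomial(2)[OF nz] in blast)
  qed
  ultimately have "mono_rank (lead_monomial h) < mono_rank (lead_monomial (f j))"
    using lead_monomial(1)[OF \<open>h \<noteq> 0\<close>] inj_mono_rank by (metis injD order_le_less)
  then show False using min[OF h] by blast
qed

text \<open>A maximal member p of the family of all (I : g * f) with g * f outside I is prime: if a
  * b is in p and a is not, then (I : a * g * f) belongs to the family, contains p and therefore
  equals p, and it contains b.\<close>

lemma colon_subset_associated_prime:
  fixes I :: "('n::finite, 'k::field) mpoly set"
  assumes I: "ideal I S_ring" and f: "f \<notin> I"
  shows "\<exists>p\<in>Ass I. colon I {f} \<subseteq> p"
proof -
  define Q where "Q = (\<lambda>g. colon I {g * f}) ` {g. g * f \<notin> I}"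
  have "colon I {1 * f} \<in> Q"
    unfolding Q_def using f by (intro imageI) simp
  moreover define R where "R = {(J', J :: ('n, 'k) mpoly set). ideal J S_ring \<and> ideal J' S_ring \<and> J \<subset> J'}"
  then have "wf R" using wf_ideals by simp
  ultimately obtain p where p: "p \<in> Q" and max: "\<And>q. (q, p) \<in> R \<Longrightarrow> q \<notin> Q"
    by (metis wfE_min)
  obtain g where g: "p = colon I {g * f}" "g * f \<notin> I" using p unfolding Q_def by (elim imageE) simp
  have "ideal p S_ring" using g ideal_colon[OF I] by blast
  moreover have "p \<noteq> UNIV"
  proof
    assume "p = UNIV"
    then have "1 \<in> p" by simp
    then show False using g by (simp add: colon_def)
  qed
  moreover have "b \<in> p" if ab: "a * b \<in> p" "a \<notin> p" for a b
  proof -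
    have "colon I {(a * g) * f} \<in> Q"
      using ab(2) g(1) unfolding Q_def by (intro imageI) (simp add: colon_def mult.assoc)
    moreover have "p \<subseteq> colon I {(a * g) * f}"
      using colon_subset_colon_mult[OF I, of "g * f" a] by (simp add: g(1) mult.assoc)
    ultimately have "p = colon I {(a * g) * f}"
      using max[of "colon I {(a * g) * f}"] ideal_colon[OF I] g(1) by (auto simp: R_def)
    moreover have "b \<in> colon I {(a * g) * f}"
      using ab(1) by (simp add: g(1) colon_def mult_ac)
    ultimately show ?thesis by blast
  qed
  ultimately have "p \<in> Ass I"
    using g(1) by (auto simp: Ass_def primeideal_S_ring_iff)
  moreover have "colon I {f} \<subseteq> p"
    using colon_subset_colon_mult[OF I] by (simp add: g(1))
  ultimately show ?thesis by blast
qed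

section \<open>Graded ideals\<close>

lemma lookup_hom_part:
  "Poly_Mapping.lookup (hom_part d f) m = (if mon_deg m = d then Poly_Mapping.lookup f m else 0)"
  by (simp add: hom_part_def lookup_mapp when_def in_keys_iff)

lemma keys_hom_part: "Poly_Mapping.keys (hom_part d f) = {m \<in> Poly_Mapping.keys f. mon_deg m = d}"
  by (auto simp: in_keys_iff lookup_hom_part split: if_splits)

lemma hom_part_in_hom_comp: "hom_part d f \<in> hom_comp d"
  by (simp add: hom_comp_def keys_hom_part)

lemma hom_part_add: "hom_part d (f + g) = hom_part d f + hom_part d g"
  by (rule poly_mapping_eqI) (simp add: lookup_hom_part lookup_add)

lemma sum_hom_parts: "f = (\<Sum>d\<in>mon_deg ` Poly_Mapping.keys f. hom_part d f)"
  by (rule poly_mapping_eqI) (auto simp: lookup_sum lookup_hom_part in_keys_iff sum.delta')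

lemma hom_part_of_hom_comp: "f \<in> hom_comp d \<Longrightarrow> hom_part d f = f"
  by (rule poly_mapping_eqI) (auto simp: lookup_hom_part hom_comp_def in_keys_iff)

lemma mon_deg_add: "mon_deg (a + b) = mon_deg a + mon_deg b"
  by (simp add: mon_deg_def lookup_add sum.distrib)

lemma degs_mult:
  assumes "k \<in> Poly_Mapping.keys (f * g)"
  obtains a b where "a \<in> Poly_Mapping.keys f" "b \<in> Poly_Mapping.keys g" "mon_deg k = mon_deg a + mon_deg b"
  using assms keys_mult[of f g] by (auto simp: mon_deg_add)

lemma hom_comp_mult: "f \<in> hom_comp d \<Longrightarrow> g \<in> hom_comp e \<Longrightarrow> f * g \<in> hom_comp (d + e)"
  by (auto simp: hom_comp_def elim: degs_mult)

lemma hom_comp_0: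
  fixes f :: "('n::finite, 'k::field) mpoly"
  assumes f: "f \<in> hom_comp 0"
  shows "f = Poly_Mapping.single 0 (Poly_Mapping.lookup f 0)"
proof (rule poly_mapping_eqI)
  fix m :: "'n \<Rightarrow>\<^sub>0 nat"
  have "m = 0" if "mon_deg m = 0"
    using that by (intro poly_mapping_eqI) (simp add: mon_deg_def)
  then show "Poly_Mapping.lookup f m = Poly_Mapping.lookup (Poly_Mapping.single 0 (Poly_Mapping.lookup f 0)) m"
    using f in_keys_iff[of m f] by (auto simp: hom_comp_def lookup_single when_def)
qed

lemma hom_part_eq_0: "d \<notin> mon_deg ` Poly_Mapping.keys f \<Longrightarrow> hom_part d f = 0"
  by (rule poly_mapping_eqI) (auto simp: lookup_hom_part in_keys_iff)

lemma hom_part_mult_hom: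
  fixes f g :: "('n::finite, 'k::field) mpoly"
  assumes g: "g \<in> hom_comp e"
  shows "hom_part (d + e) (f * g) = hom_part d f * g"
proof -
  define f' where "f' = f - hom_part d f"
  have f': "mon_deg k \<noteq> d" if "k \<in> Poly_Mapping.keys f'" for k
    using that by (auto simp: f'_def in_keys_iff lookup_minus lookup_hom_part)
  have "hom_part (d + e) (f' * g) = 0"
  proof (intro hom_part_eq_0 notI)
    assume "d + e \<in> mon_deg ` Poly_Mapping.keys (f' * g)"
    then obtain k where k: "k \<in> Poly_Mapping.keys (f' * g)" "mon_deg k = d + e" by auto
    from k(1) show False
    proof (rule degs_mult)
      fix a b assume "a \<in> Poly_Mapping.keys f'" "b \<in> Poly_Mapping.keys g" "mon_deg k = mon_deg a + mon_deg b"
      then show False using f'[of a] g k(2) by (simp add: hom_comp_def)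
    qed
  qed
  moreover have "f * g = hom_part d f * g + f' * g"
    by (simp add: f'_def algebra_simps)
  moreover have "hom_part (d + e) (hom_part d f * g) = hom_part d f * g"
    by (intro hom_part_of_hom_comp hom_comp_mult hom_part_in_hom_comp g)
  ultimately show ?thesis by (simp add: hom_part_add)
qed

text \<open>All other products of components have degree above a + b. Since \<open>a\<close> and
  \<open>b\<close> are only lower bounds, the parts named may vanish; this is needed where it is
  known only that the components below \<open>a\<close> have been removed.\<close>

lemma hom_part_mult_lowest:
  fixes f g :: "('n::finite, 'k::field) mpoly"
  assumes f: "\<And>k. k \<in> Poly_Mapping.keys f \<Longrightarrow> a \<le> mon_deg k"
    and g: "\<And>k. k \<in> Poly_Mapping.keys g \<Longrightarrow> b \<le> mon_deg k"
  shows "hom_part (a + b) (f * g) = hom_part a f * hom_part b g"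
proof -
  define f' g' where "f' = f - hom_part a f" and "g' = g - hom_part b g"
  have f': "a < mon_deg k" if "k \<in> Poly_Mapping.keys f'" for k
    using that f[of k] by (auto simp: f'_def in_keys_iff lookup_minus lookup_hom_part split: if_splits)
  have g': "b < mon_deg k" if "k \<in> Poly_Mapping.keys g'" for k
    using that g[of k] by (auto simp: g'_def in_keys_iff lookup_minus lookup_hom_part split: if_splits)
  have "f * g = hom_part a f * hom_part b g + (hom_part a f * g' + f' * g)"
    by (simp add: f'_def g'_def algebra_simps)
  moreover have "hom_part (a + b) (hom_part a f * g') = 0"
  proof (intro hom_part_eq_0 notI)
    assume "a + b \<in> mon_deg ` Poly_Mapping.keys (hom_part a f * g')"
    then obtain k where k: "k \<in> Poly_Mapping.keys (hom_part a f * g')" "mon_deg k = a + b" by auto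
    from k(1) show False
    proof (rule degs_mult)
      fix x y assume "x \<in> Poly_Mapping.keys (hom_part a f)" "y \<in> Poly_Mapping.keys g'"
        "mon_deg k = mon_deg x + mon_deg y"
      then show False using g'[of y] k(2) by (simp add: keys_hom_part)
    qed
  qed
  moreover have "hom_part (a + b) (f' * g) = 0"
  proof (intro hom_part_eq_0 notI)
    assume "a + b \<in> mon_deg ` Poly_Mapping.keys (f' * g)"
    then obtain k where k: "k \<in> Poly_Mapping.keys (f' * g)" "mon_deg k = a + b" by auto
    from k(1) show False
    proof (rule degs_mult)
      fix x y assume "x \<in> Poly_Mapping.keys f'" "y \<in> Poly_Mapping.keys g"
        "mon_deg k = mon_deg x + mon_deg y"
      then show False using f'[of x] g[of y] k(2) by simp
    qed
  qed
  moreover have "hom_part (a + b) (hom_part a f * hom_part b g) = hom_part a f * hom_part b g"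
    by (intro hom_part_of_hom_comp hom_comp_mult hom_part_in_hom_comp)
  ultimately show ?thesis by (simp add: hom_part_add)
qed

text \<open>Among all \<open>m\<close> with \<open>(I : m) = p\<close> take one with the fewest homogeneous components; its
  lowest component is the required element.\<close>

lemma associated_prime_homogeneous:
  fixes I :: "('n::finite, 'k::field) mpoly set"
  assumes "graded_ideal I" and prime: "primeideal p S_ring" and "colon I {m0} = p"
  shows "\<exists>d. \<exists>f\<in>hom_comp d. colon I {f} = p"
proof -
  have I: "ideal I S_ring" and hom: "\<And>f d. f \<in> I \<Longrightarrow> hom_part d f \<in> I"
    using assms(1) by (auto simp: graded_ideal_def)
  have p: "ideal p S_ring" "p \<noteq> UNIV"
    using prime by (auto simp: primeideal_S_ring_iff)
  obtain m where m: "colon I {m} = p"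
    and min: "\<And>m'. colon I {m'} = p \<Longrightarrow> card (mon_deg ` Poly_Mapping.keys m) \<le> card (mon_deg ` Poly_Mapping.keys m')"
    using ex_has_least_nat[of "\<lambda>m. colon I {m} = p" m0 "\<lambda>m. card (mon_deg ` Poly_Mapping.keys m)"] assms(3)
    by blast
  have "m \<noteq> 0"
    using m p ideal_zero[OF I] by (auto simp: colon_def)
  then have ne: "mon_deg ` Poly_Mapping.keys m \<noteq> {}"
    by (auto simp: poly_mapping_eq_iff fun_eq_iff in_keys_iff)
  define b where "b = Min (mon_deg ` Poly_Mapping.keys m)"
  have b_in: "b \<in> mon_deg ` Poly_Mapping.keys m"
    unfolding b_def using ne by (intro Min_in) auto
  have b_le: "b \<le> mon_deg k" if "k \<in> Poly_Mapping.keys m" for k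
    unfolding b_def using that by (intro Min_le) auto
  define mb where "mb = hom_part b m"
  \<comment> \<open>If r were outside p, then r * m would be another witness of p, and modulo I it
    equals r * (m - mb), which has fewer homogeneous components than m.\<close>
  have key: "r \<in> p" if r: "r \<in> hom_comp d" "r * mb \<in> I" for r d
  proof (rule ccontr)
    assume "r \<notin> p"
    define m' where "m' = r * (m - mb)"
    have "colon I {r * m} = p"
      by (rule colon_prime_eq[OF I m prime \<open>r \<notin> p\<close>])
    moreover have "colon I {r * m} = colon I {m'}"
      using r(2) by (intro colon_cong[OF I]) (simp add: m'_def algebra_simps)
    ultimately have "card (mon_deg ` Poly_Mapping.keys m) \<le> card (mon_deg ` Poly_Mapping.keys m')"
      using min by simp
    also have "\<dots> \<le> card ((+) d ` (mon_deg ` Poly_Mapping.keys m - {b}))"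
    proof (intro card_mono subsetI)
      fix e assume "e \<in> mon_deg ` Poly_Mapping.keys m'"
      then obtain k where k: "k \<in> Poly_Mapping.keys m'" "e = mon_deg k" by auto
      then obtain x y where xy: "x \<in> Poly_Mapping.keys r" "y \<in> Poly_Mapping.keys (m - mb)"
          "e = mon_deg x + mon_deg y"
        by (auto simp: m'_def elim: degs_mult)
      have "y \<in> Poly_Mapping.keys m" "mon_deg y \<noteq> b"
        using xy(2) by (auto simp: mb_def in_keys_iff lookup_minus lookup_hom_part split: if_splits)
      moreover have "mon_deg x = d" using r(1) xy(1) by (simp add: hom_comp_def)
      ultimately show "e \<in> (+) d ` (mon_deg ` Poly_Mapping.keys m - {b})"
        using xy(3) by blast
    qed simp
    also have "\<dots> \<le> card (mon_deg ` Poly_Mapping.keys m - {b})"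
      by (intro card_image_le) simp
    also have "\<dots> < card (mon_deg ` Poly_Mapping.keys m)"
      using b_in by (intro card_Diff1_less) auto
    finally show False by simp
  qed
  \<comment> \<open>That p is itself homogeneous. The components of f below degree a are in p by
    induction; once they are removed, the component of degree a + b in f' * m is
    \<open>hom_part a f * mb\<close>, which is in I because I is graded, and \<open>key\<close>
    applies.\<close>
  have graded: "hom_part d f \<in> p" if "f \<in> p" for f d
  proof (induction d rule: less_induct)
    case (less a)
    define f' where "f' = f - (\<Sum>d<a. hom_part d f)"
    have lookup: "Poly_Mapping.lookup f' k = (if mon_deg k < a then 0 else Poly_Mapping.lookup f k)" for k
      by (simp add: f'_def lookup_minus lookup_sum lookup_hom_part sum.delta')
    have "f' \<in> p"
      unfolding f'_def using that less by (intro ideal_diff[OF p(1)] ideal_sum[OF p(1)]) auto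
    then have "f' * m \<in> I" using m by (auto simp: colon_def)
    then have "hom_part (a + b) (f' * m) \<in> I" by (rule hom)
    moreover have "hom_part (a + b) (f' * m) = hom_part a f' * mb"
      unfolding mb_def using b_le
      by (intro hom_part_mult_lowest) (auto simp: in_keys_iff lookup split: if_splits)
    moreover have "hom_part a f' = hom_part a f"
      by (rule poly_mapping_eqI) (simp add: lookup_hom_part lookup)
    ultimately show ?case
      using key[OF hom_part_in_hom_comp] by simp
  qed
  have hom_mb: "hom_part (d + b) (g * m) = g * mb" if "g \<in> hom_comp d" for g d
    using hom_part_mult_lowest[of g d m b] b_le that hom_part_of_hom_comp[OF that]
    by (auto simp: mb_def hom_comp_def)
  have "colon I {mb} = p"
  proof
    show "p \<subseteq> colon I {mb}"
    proof
      fix f assume "f \<in> p"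
      have "hom_part d f * mb \<in> I" for d
        using graded[OF \<open>f \<in> p\<close>, of d] m hom[of "hom_part d f * m" "d + b"]
          hom_mb[OF hom_part_in_hom_comp, of d f]
        by (auto simp: colon_def)
      then have "(\<Sum>d\<in>mon_deg ` Poly_Mapping.keys f. hom_part d f * mb) \<in> I"
        by (intro ideal_sum[OF I])
      then show "f \<in> colon I {mb}"
        by (simp add: colon_def sum_hom_parts[symmetric] flip: sum_distrib_right)
    qed
    show "colon I {mb} \<subseteq> p"
    proof
      fix r assume "r \<in> colon I {mb}"
      then have r: "r * mb \<in> I" by (simp add: colon_def)
      have "hom_part d r \<in> p" for d
      proof (rule key[OF hom_part_in_hom_comp])
        have "hom_part d r * mb = hom_part (d + b) (r * mb)"
          unfolding mb_def by (rule hom_part_mult_hom[OF hom_part_in_hom_comp, symmetric])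
        then show "hom_part d r * mb \<in> I" using hom[OF r] by simp
      qed
      then have "(\<Sum>d\<in>mon_deg ` Poly_Mapping.keys r. hom_part d r) \<in> p"
        by (intro ideal_sum[OF p(1)])
      then show "r \<in> p" by (simp flip: sum_hom_parts)
    qed
  qed
  then show ?thesis using hom_part_in_hom_comp unfolding mb_def by blast
qed

section \<open>The v-number\<close>

text \<open>Every monomial occurring in f is nonconstant, hence a multiple of some variable.\<close>

lemma lookup_0_imp_max_ideal:
  fixes f :: "('n::finite, 'k::field) mpoly"
  assumes "Poly_Mapping.lookup f 0 = 0"
  shows "f \<in> max_ideal"
proof -
  interpret S: cring "S_ring :: ('n, 'k) mpoly ring"
    by (rule cring_from_type_algebra)
  have carrier: "range Defs.var \<subseteq> carrier (S_ring :: ('n, 'k) mpoly ring)"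
    by (simp add: ring_of_type_algebra_def)
  have m: "ideal (max_ideal :: ('n, 'k) mpoly set) S_ring"
    unfolding max_ideal_def by (rule S.genideal_ideal[OF carrier])
  have var: "(Defs.var i :: ('n, 'k) mpoly) \<in> max_ideal" for i
    unfolding max_ideal_def using S.genideal_self[OF carrier] by blast
  have "Poly_Mapping.single k (Poly_Mapping.lookup f k) \<in> max_ideal" if k: "k \<in> Poly_Mapping.keys f" for k
  proof -
    have "k \<noteq> 0" using k assms by (auto simp: in_keys_iff)
    then obtain i where i: "Poly_Mapping.lookup k i \<noteq> 0"
      by (metis lookup_zero poly_mapping_eqI)
    have "k = (k - Poly_Mapping.single i 1) + Poly_Mapping.single i 1"
      using i by (intro poly_mapping_eqI) (auto simp: lookup_add lookup_minus lookup_single when_def)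
    then have "Poly_Mapping.single k (Poly_Mapping.lookup f k) =
        Poly_Mapping.single (k - Poly_Mapping.single i 1) (Poly_Mapping.lookup f k) * Defs.var i"
      unfolding Defs.var_def mult_single by simp
    then show ?thesis using ideal_mult[OF m var] by simp
  qed
  then show ?thesis
    by (subst mpoly_sum_monomials) (rule ideal_sum[OF m])
qed

lemma max_ideal_maximal:
  fixes p :: "('n::finite, 'k::field) mpoly set"
  assumes "ideal p S_ring" "max_ideal \<subseteq> p" "p \<noteq> UNIV"
  shows "p = max_ideal"
proof
  show "p \<subseteq> max_ideal"
  proof
    fix f assume "f \<in> p"
    let ?c = "Poly_Mapping.single 0 (Poly_Mapping.lookup f 0) :: ('n, 'k) mpoly"
    have "f - ?c \<in> p"
      using assms(2) lookup_0_imp_max_ideal[of "f - ?c"] by (auto simp: lookup_minus)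
    then have "?c \<in> p"
      using ideal_cancel[OF assms(1), of f ?c] \<open>f \<in> p\<close> by simp
    then show "f \<in> max_ideal"
      using const_notin_ideal[OF assms(1,3)] by (intro lookup_0_imp_max_ideal) simp
  qed
qed fact

text \<open>A coset is zero exactly when its representative lies in I. The given witness rules out
  the zero module, on which \<open>alpha\<close> would return its conventional 0.\<close>

lemma alpha_quot_eq:
  assumes I: "ideal I S_ring" and "f \<in> hom_comp d" "f \<in> J" "f \<notin> I"
  shows "alpha_quot J I = (LEAST d. \<exists>f\<in>hom_comp d. f \<in> J \<and> f \<notin> I)"
proof -
  have ex: "(\<exists>x\<in>quot_comp J I d. x \<noteq> I) \<longleftrightarrow> (\<exists>f\<in>hom_comp d. f \<in> J \<and> f \<notin> I)" for d
    using colon_coset_eq_iff[OF I] by (auto simp: quot_comp_def)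
  then have "\<not> (\<forall>d. quot_comp J I d \<subseteq> {I})"
    using assms by blast
  then show ?thesis unfolding alpha_quot_def alpha_def ex by (rule if_not_P)
qed

lemma unmixed_colon_eq:
  fixes I :: "('n::finite, 'k::field) mpoly set"
  assumes I: "ideal I S_ring" and "unmixed I" and p: "p \<in> Ass I" and f: "f \<in> colon I p" "f \<notin> I"
  shows "colon I {f} = p"
proof -
  obtain q where q: "q \<in> Ass I" "colon I {f} \<subseteq> q"
    using colon_subset_associated_prime[OF I f(2)] by blast
  have "p \<subseteq> colon I {f}"
    using f(1) by (auto simp: colon_def mult.commute)
  moreover have "height p = height q"
    using \<open>unmixed I\<close> p q(1) unfolding unmixed_def by blast
  then have "\<not> p \<subset> q"
    using height_strict_mono[of p q] p q(1) by (auto simp: Ass_def)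
  ultimately show ?thesis using q(2) by blast
qed

lemma colon_eq_imp_mem:
  assumes "colon I {f} = p" "p \<noteq> UNIV" "ideal I S_ring"
  shows "f \<in> colon I p" and "f \<notin> I"
  using assms ideal_mult[of I f] by (auto simp: colon_def mult.commute)

text \<open>Interchanges the minimum over degrees with the one over associated primes.
  Satisfiability of each \<open>Q p\<close> keeps unspecified values of \<open>LEAST\<close> out of
  the set on the right.\<close>

lemma Least_Least:
  fixes Q :: "'a \<Rightarrow> nat \<Rightarrow> bool"
  assumes "A \<noteq> {}" and ex: "\<And>p. p \<in> A \<Longrightarrow> \<exists>d. Q p d"
  shows "(LEAST d. \<exists>p\<in>A. Q p d) = (LEAST a. a \<in> {LEAST d. Q p d | p. p \<in> A})"
proof (rule sym, rule Least_equality)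
  have "\<exists>d. \<exists>p\<in>A. Q p d" using assms by blast
  then obtain p where p: "p \<in> A" "Q p (LEAST d. \<exists>p\<in>A. Q p d)"
    using LeastI_ex[of "\<lambda>d. \<exists>p\<in>A. Q p d"] by blast
  have "(LEAST d. Q p d) = (LEAST d. \<exists>p\<in>A. Q p d)"
    using p ex[OF p(1)] by (intro antisym Least_le bexI[of _ p] LeastI_ex[of "Q p"]) auto
  then show "(LEAST d. \<exists>p\<in>A. Q p d) \<in> {LEAST d. Q p d | p. p \<in> A}"
    using p(1) by force
next
  fix a assume "a \<in> {LEAST d. Q p d | p. p \<in> A}"
  then obtain p where "p \<in> A" "a = (LEAST d. Q p d)" by blast
  then show "(LEAST d. \<exists>p\<in>A. Q p d) \<le> a"
    using LeastI_ex[OF ex] by (intro Least_le) blast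
qed

text \<open>The two equations are guarded because they fail for a graded prime \<open>I\<close>
  other than \<open>max_ideal\<close>: its only associated prime is \<open>I\<close>, and 1 lies in
  \<open>colon I I\<close>, so the left side is 0 while degrees below 1 are excluded on the right.
  Properness of \<open>I\<close> makes \<open>Ass I\<close> nonempty.\<close>

theorem proposition4p2:
  fixes I :: "('n::finite, 'k::field) mpoly set"
  assumes "graded_ideal I" and "I \<noteq> UNIV" and "unmixed I"
  shows "(\<forall>p\<in>Ass I. I \<subset> colon I p) \<and>
    ((primeideal I S_ring \<longrightarrow> I = max_ideal) \<longrightarrow>
      v_number I = (LEAST a. a \<in> {alpha_quot (colon I p) I | p. p \<in> Ass I}) \<and>
      (\<forall>p\<in>Ass I. alpha_quot (colon I p) I = local_v_number p I))"
proof -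
  have I: "ideal I S_ring"
    using \<open>graded_ideal I\<close> by (simp add: graded_ideal_def)
  have "1 \<notin> I" using ideal_eq_UNIV[OF I] \<open>I \<noteq> UNIV\<close> by blast
  then have Ass_ne: "Ass I \<noteq> {}"
    using colon_subset_associated_prime[OF I] by blast
  have Ass: "primeideal p S_ring" "ideal p S_ring" "p \<noteq> UNIV" if "p \<in> Ass I" for p
    using that by (auto simp: Ass_def primeideal_S_ring_iff)
  have sub: "I \<subset> colon I p" if p: "p \<in> Ass I" for p
  proof -
    obtain f where "colon I {f} = p" using p by (auto simp: Ass_def)
    then have "f \<in> colon I p" "f \<notin> I"
      using colon_eq_imp_mem Ass(3)[OF p] I by blast+
    then show ?thesis using ideal_subset_colon[OF I, of p] by blast
  qed
  \<comment> \<open>Here p = I, so \<open>colon I p\<close> contains 1, an element of degree 0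
    outside I; this agrees with the convention that the v-number is 0.\<close>
  have max_case: "alpha_quot (colon I p) I = 0" if "I = max_ideal" "p \<in> Ass I" for p
  proof -
    have "I \<subseteq> p" using that(2) ideal_subset_colon[OF I] by (auto simp: Ass_def)
    then have "p = I" using max_ideal_maximal Ass that by blast
    then have "1 \<in> colon I p" by (simp add: colon_def)
    moreover have one: "1 \<in> hom_comp 0" by (simp add: hom_comp_def mon_deg_def)
    ultimately show ?thesis
      unfolding alpha_quot_eq[OF I one \<open>1 \<in> colon I p\<close> \<open>1 \<notin> I\<close>]
      using \<open>1 \<notin> I\<close> by (intro Least_eq_0) blast
  qed
  have "v_number I = (LEAST a. a \<in> {alpha_quot (colon I p) I | p. p \<in> Ass I}) \<and>
      (\<forall>p\<in>Ass I. alpha_quot (colon I p) I = local_v_number p I)"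
    if prime: "primeideal I S_ring \<longrightarrow> I = max_ideal"
  proof (cases "I = max_ideal")
    case True
    have "{alpha_quot (colon I p) I | p. p \<in> Ass I} = {0}"
      using max_case[OF True] Ass_ne by force
    then show ?thesis
      using max_case[OF True] True by (simp add: v_number_def local_v_number_def)
  next
    case False
    \<comment> \<open>A witness of degree 0 is a nonzero constant, hence a unit, so p = (I : f) = I
      would be prime. This is where the guard on prime ideals enters; it lets the condition that d
      is at least 1 be added for free in \<open>iff\<close>.\<close>
    have pos: "1 \<le> d" if p: "p \<in> Ass I" and f: "f \<in> hom_comp d" "colon I {f} = p" for p f d
    proof (rule ccontr)
      assume "\<not> 1 \<le> d"
      then have "d = 0" by simp
      then have "f \<in> hom_comp 0" using f by simp
      then obtain c where c: "f = Poly_Mapping.single 0 c" using hom_comp_0 by blast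
      have "f \<notin> I" using colon_eq_imp_mem f(2) Ass(3)[OF p] I by blast
      then have "c \<noteq> 0" using c ideal_zero[OF I] by auto
      then have inv: "Poly_Mapping.single 0 (1 / c) * f = 1" by (simp add: c mult_single)
      have "g \<in> I" if "g * f \<in> I" for g
        using ideal_mult[OF I that, of "Poly_Mapping.single 0 (1 / c)"] inv
        by (simp add: mult.left_commute)
      then have "colon I {f} \<subseteq> I" unfolding colon_def by blast
      then have "colon I {f} = I" using ideal_subset_colon[OF I] by (rule antisym)
      then show False using f(2) Ass(1)[OF p] prime False by simp
    qed
    have iff: "(\<exists>f\<in>hom_comp d. f \<in> colon I p \<and> f \<notin> I) \<longleftrightarrow> d \<ge> 1 \<and> (\<exists>f\<in>hom_comp d. colon I {f} = p)"
      if p: "p \<in> Ass I" for p d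
      using unmixed_colon_eq[OF I \<open>unmixed I\<close> p] colon_eq_imp_mem[OF _ Ass(3)[OF p] I] pos[OF p]
      by blast
    have ex: "\<exists>d. d \<ge> 1 \<and> (\<exists>f\<in>hom_comp d. colon I {f} = p)" if p: "p \<in> Ass I" for p
    proof -
      obtain m where "colon I {m} = p" using p by (auto simp: Ass_def)
      from associated_prime_homogeneous[OF \<open>graded_ideal I\<close> Ass(1)[OF p] this]
      show ?thesis using pos[OF p] by blast
    qed
    have alpha: "alpha_quot (colon I p) I = (LEAST d. d \<ge> 1 \<and> (\<exists>f\<in>hom_comp d. colon I {f} = p))"
      if p: "p \<in> Ass I" for p
    proof -
      obtain d f where "f \<in> hom_comp d" "f \<in> colon I p" "f \<notin> I"
        using ex[OF p] iff[OF p] by blast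
      from alpha_quot_eq[OF I this] show ?thesis by (simp only: iff[OF p])
    qed
    have "(d \<ge> 1 \<and> (\<exists>f\<in>hom_comp d. \<exists>p\<in>Ass I. colon I {f} = p)) \<longleftrightarrow>
        (\<exists>p\<in>Ass I. d \<ge> 1 \<and> (\<exists>f\<in>hom_comp d. colon I {f} = p))" for d
      by blast
    then have "v_number I = (LEAST d. \<exists>p\<in>Ass I. d \<ge> 1 \<and> (\<exists>f\<in>hom_comp d. colon I {f} = p))"
      using False by (simp only: v_number_def if_False)
    also have "\<dots> = (LEAST a. a \<in> {LEAST d. d \<ge> 1 \<and> (\<exists>f\<in>hom_comp d. colon I {f} = p) | p. p \<in> Ass I})"
      by (rule Least_Least[OF Ass_ne ex])
    also have "{LEAST d. d \<ge> 1 \<and> (\<exists>f\<in>hom_comp d. colon I {f} = p) | p. p \<in> Ass I} =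
        {alpha_quot (colon I p) I | p. p \<in> Ass I}"
      by (intro Collect_cong ex_cong1 rev_conj_cong refl) (simp only: alpha)
    finally show ?thesis
      using alpha False by (simp add: local_v_number_def)
  qed
  then show ?thesis using sub by blast
qed

end
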